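(* There exists a $\Pi^0_1$ class $\mathcal{P}\subseteq 2^\omega$ such that the degree spectrum of $\mathcal{P}$ is an infinite strict chain; that is, the degree spectrum of $\mathcal{P}$ equals $\{\mathbf{a}_i\}_{i\in\omega}$ for some infinite sequence of Turing degrees with $\mathbf{a}_n<\mathbf{a}_m$ whenever $n<m$.
   Context: $\omega$ is the set of natural numbers; $2^{<\omega}$ is the set of finite binary strings; a set $A\subseteq\omega$ is identified with its characteristic function, an element of Cantor space $2^\omega$. A set $\Lambda\subseteq 2^{<\omega}$ is downward closed if whenever $\sigma\in\Lambda$ and $\tau$ is an initial segment of $\sigma$, then $\tau\in\Lambda$. $[\Lambda]$ denotes the set of infinite paths through $\Lambda$, i.e. all $A\in 2^\omega$ every initial segment of which is in $\Lambda$. A class $\mathcal{P}\subseteq 2^\omega$ is a $\Pi^0_1$ class if $\mathcal{P}=[\Lambda]$ for some computable downward closed set of strings $\Lambda$. The degree spectrum of a $\Pi^0_1$ class $\mathcal{P}$ is the set of all Turing degrees $\mathbf{a}$ such that there exists a member $A\in\mathcal{P}$ of degree $\mathbf{a}$. An infinite sequence $\{\mathbf{a}_i\}_{i\in\omega}$ of Turing degrees is a strict chain if $\mathbf{a}_n<\mathbf{a}_m$ whenever $n<m$, where $<$ is the strict order on Turing degrees induced by Turing reducibility. *)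

theory Defs
  imports Main "HOL-Library.Sublist" "HOL-Library.Nat_Bijection"
begin

section \<open>Partial recursive functions relative to a set\<close>

text \<open>
  Kleene's schemes for the functions partial recursive in a set \<open>X\<close>; \<open>Query\<close> is the characteristic
  function of \<open>X\<close>. Arities are not tracked syntactically: a program applied to an argument list of
  the wrong length diverges (value \<open>None\<close>), except that \<open>Zero\<close> is the constant zero function of
  every arity and \<open>Proj i\<close> is the projection to position \<open>i\<close> in every arity exceeding \<open>i\<close>.
\<close>

datatype prog =
    Zero
  | Succ
  | Proj nat
  | Query
  | Comp prog "prog list"
  | PrimRec prog prog
  | Mu prog

fun run :: "nat set \<Rightarrow> prog \<Rightarrow> nat list \<Rightarrow> nat option" where
  "run X Zero xs = Some 0"
| "run X Succ xs = (case xs of [x] \<Rightarrow> Some (Suc x) | _ \<Rightarrow> None)"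
| "run X (Proj i) xs = (if i < length xs then Some (xs ! i) else None)"
| "run X Query xs = (case xs of [x] \<Rightarrow> Some (of_bool (x \<in> X)) | _ \<Rightarrow> None)"
| "run X (Comp p qs) xs =
     (case those (map (\<lambda>q. run X q xs) qs) of None \<Rightarrow> None | Some ys \<Rightarrow> run X p ys)"
| "run X (PrimRec p q) xs =
     (case xs of
        [] \<Rightarrow> None
      | n # zs \<Rightarrow>
          rec_nat (run X p zs)
            (\<lambda>k r. case r of None \<Rightarrow> None | Some y \<Rightarrow> run X q (y # k # zs)) n)"
| "run X (Mu p) xs =
     (if \<exists>y. run X p (y # xs) = Some 0 \<and> (\<forall>z<y. \<exists>v. run X p (z # xs) = Some (Suc v))
      then Some (LEAST y. run X p (y # xs) = Some 0) else None)"

fun query_free :: "prog \<Rightarrow> bool" where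
  "query_free Zero \<longleftrightarrow> True"
| "query_free Succ \<longleftrightarrow> True"
| "query_free (Proj i) \<longleftrightarrow> True"
| "query_free Query \<longleftrightarrow> False"
| "query_free (Comp p qs) \<longleftrightarrow> query_free p \<and> (\<forall>q\<in>set qs. query_free q)"
| "query_free (PrimRec p q) \<longleftrightarrow> query_free p \<and> query_free q"
| "query_free (Mu p) \<longleftrightarrow> query_free p"

definition decides :: "nat set \<Rightarrow> prog \<Rightarrow> nat set \<Rightarrow> bool" where
  "decides X p A \<longleftrightarrow> (\<forall>n. run X p [n] = Some (of_bool (n \<in> A)))"

text \<open>The set passed to a query-free program is irrelevant (lemma \<open>run_query_free\<close>).\<close>

definition computable :: "nat set \<Rightarrow> bool" where
  "computable A \<longleftrightarrow> (\<exists>p. query_free p \<and> decides {} p A)"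

definition turing_le :: "nat set \<Rightarrow> nat set \<Rightarrow> bool"  (infix "\<le>\<^sub>T" 50) where
  "A \<le>\<^sub>T B \<longleftrightarrow> (\<exists>p. decides B p A)"

definition turing_equiv :: "nat set \<Rightarrow> nat set \<Rightarrow> bool"  (infix "\<equiv>\<^sub>T" 50) where
  "A \<equiv>\<^sub>T B \<longleftrightarrow> A \<le>\<^sub>T B \<and> B \<le>\<^sub>T A"

lemma run_query_free: "query_free p \<Longrightarrow> run X p xs = run Y p xs"
proof (induction p arbitrary: xs)
  case (Comp p qs)
  have args: "map (\<lambda>q. run X q xs) qs = map (\<lambda>q. run Y q xs) qs"
    using Comp by auto
  have body: "run X p = run Y p" using Comp by auto
  show ?case unfolding run.simps args body ..
next
  case (PrimRec p q)
  have "run X p = run Y p" "run X q = run Y q" using PrimRec by auto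
  then show ?case by (cases xs) simp_all
next
  case (Mu p)
  have "run X p = run Y p" using Mu by auto
  then show ?case by simp
qed simp_all

text \<open>
  Replacing queries by a program; the extra argument \<open>Succ\<close> only forces divergence on argument
  lists of length other than one, so that the replacement agrees with \<open>Query\<close> there as well.
\<close>

fun subst_query :: "prog \<Rightarrow> prog \<Rightarrow> prog" where
  "subst_query r Zero = Zero"
| "subst_query r Succ = Succ"
| "subst_query r (Proj i) = Proj i"
| "subst_query r Query = Comp (Proj 0) [r, Succ]"
| "subst_query r (Comp p qs) = Comp (subst_query r p) (map (subst_query r) qs)"
| "subst_query r (PrimRec p q) = PrimRec (subst_query r p) (subst_query r q)"
| "subst_query r (Mu p) = Mu (subst_query r p)"

lemma run_subst_query:
  assumes "decides X r Y"
  shows "run X (subst_query r p) xs = run Y p xs"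
proof (induction p arbitrary: xs)
  case Query
  show ?case
    using assms by (auto simp: decides_def split: list.split option.split)
next
  case (Comp p qs)
  have args: "map (\<lambda>q. run X q xs) (map (subst_query r) qs) = map (\<lambda>q. run Y q xs) qs"
    using Comp by auto
  have body: "run X (subst_query r p) = run Y p" using Comp by auto
  show ?case unfolding run.simps subst_query.simps args body ..
next
  case (PrimRec p q)
  have "run X (subst_query r p) = run Y p" "run X (subst_query r q) = run Y q"
    using PrimRec by auto
  then show ?case by (cases xs) simp_all
next
  case (Mu p)
  have "run X (subst_query r p) = run Y p" using Mu by auto
  then show ?case by simp
qed simp_all

lemma turing_le_refl: "A \<le>\<^sub>T A"
  unfolding turing_le_def decides_def by (rule exI[of _ Query]) simp

lemma turing_le_trans: "A \<le>\<^sub>T B \<Longrightarrow> B \<le>\<^sub>T C \<Longrightarrow> A \<le>\<^sub>T C"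
  unfolding turing_le_def by (metis decides_def run_subst_query)

lemma query_free_subst_query: "query_free r \<Longrightarrow> query_free (subst_query r p)"
  by (induction p) auto

lemma computable_iff_turing_le_empty: "computable A \<longleftrightarrow> A \<le>\<^sub>T {}"
proof
  assume "A \<le>\<^sub>T {}"
  then obtain p where "decides {} p A" by (auto simp: turing_le_def)
  moreover have "decides {} Zero {}" by (simp add: decides_def)
  ultimately have "decides {} (subst_query Zero p) A"
    by (simp add: decides_def run_subst_query)
  then show "computable A"
    unfolding computable_def using query_free_subst_query[of Zero p] by auto
qed (auto simp: computable_def turing_le_def)


section \<open>Turing degrees\<close>

quotient_type turing_degree = "nat set" / turing_equiv
proof (rule equivpI)
  show "reflp turing_equiv"
    by (auto simp: turing_equiv_def turing_le_refl intro: reflpI)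
  show "symp turing_equiv"
    by (auto simp: turing_equiv_def intro: sympI)
  show "transp turing_equiv"
    unfolding turing_equiv_def by (rule transpI) (blast intro: turing_le_trans)
qed

lift_definition degree_of :: "nat set \<Rightarrow> turing_degree" is "\<lambda>A. A" .

instantiation turing_degree :: order
begin

lift_definition less_eq_turing_degree :: "turing_degree \<Rightarrow> turing_degree \<Rightarrow> bool" is turing_le
  by (auto simp: turing_equiv_def intro: turing_le_trans)

definition less_turing_degree :: "turing_degree \<Rightarrow> turing_degree \<Rightarrow> bool" where
  "a < b \<longleftrightarrow> a \<le> b \<and> \<not> b \<le> a" for a b :: turing_degree

instance
proof
  fix a b c :: turing_degree
  show "a < b \<longleftrightarrow> a \<le> b \<and> \<not> b \<le> a" by (rule less_turing_degree_def)
  show "a \<le> a" by transfer (rule turing_le_refl)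
  show "a \<le> b \<Longrightarrow> b \<le> c \<Longrightarrow> a \<le> c" by transfer (rule turing_le_trans)
  show "a \<le> b \<Longrightarrow> b \<le> a \<Longrightarrow> a = b" by transfer (simp add: turing_equiv_def)
qed

end


section \<open>Effectively closed classes in Cantor space\<close>

text \<open>
  Elements of Cantor space are sets of naturals (identified with their characteristic functions);
  finite binary strings are lists of Booleans, coded as natural numbers by the bijection
  \<^const>\<open>list_encode\<close>.
\<close>

definition string_code :: "bool list \<Rightarrow> nat" where
  "string_code s = list_encode (map of_bool s)"

definition computable_strings :: "bool list set \<Rightarrow> bool" where
  "computable_strings L \<longleftrightarrow> computable (string_code ` L)"

definition downward_closed :: "bool list set \<Rightarrow> bool" where
  "downward_closed L \<longleftrightarrow> (\<forall>s\<in>L. \<forall>t. prefix t s \<longrightarrow> t \<in> L)"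

definition initial_segment :: "nat set \<Rightarrow> nat \<Rightarrow> bool list" where
  "initial_segment A n = map (\<lambda>i. i \<in> A) [0..<n]"

definition paths :: "bool list set \<Rightarrow> nat set set" where
  "paths L = {A. \<forall>n. initial_segment A n \<in> L}"

definition pi01_class :: "nat set set \<Rightarrow> bool" where
  "pi01_class P \<longleftrightarrow> (\<exists>L. computable_strings L \<and> downward_closed L \<and> P = paths L)"

definition degree_spectrum :: "nat set set \<Rightarrow> turing_degree set" where
  "degree_spectrum P = {a. \<exists>A\<in>P. degree_of A = a}"

definition strict_chain :: "(nat \<Rightarrow> turing_degree) \<Rightarrow> bool" where
  "strict_chain a \<longleftrightarrow> (\<forall>n m. n < m \<longrightarrow> a n < a m)"

end

theory Submission imports Defs begin

text \<open>
  The chain consists of the degrees of \<open>level 0 = UNIV\<close>, \<open>level (n + 1) = jump (level n)\<close>, where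
  \<open>jump\<close> is the halting problem relative to an oracle. It is strictly increasing by
  diagonalisation (\<open>le_jump\<close>, \<open>not_jump_le\<close>).

  The \<open>n\<close>-th iterated jump is coded by the unique solution with \<open>f 0 = n\<close> of a condition that is
  \<open>\<Pi>\<^sup>0\<^sub>1\<close> in a function \<open>f : \<omega> \<rightarrow> \<omega>\<close>. Split \<open>f\<close> into columns \<open>e \<mapsto> f \<langle>i, e\<rangle>\<close>. Column \<open>0\<close> is
  constantly \<open>n\<close>, columns beyond \<open>n\<close> vanish, and for \<open>1 \<le> i \<le> n\<close> the entry \<open>f \<langle>i, e\<rangle>\<close> is \<open>0\<close> if \<open>e\<close> is not in the jump of the
  support of column \<open>i - 1\<close>, and otherwise \<open>1 + t\<close> for the least witness \<open>t\<close> of membership. That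
  \<open>t\<close> is the least witness depends on finitely many entries only (\<open>least_witness_use\<close>), so any
  violation shows up in a finite part of \<open>f\<close>. By induction on the columns, the value \<open>n = f 0\<close>
  determines \<open>f\<close> (\<open>coherent_unique\<close>); the solution is \<open>skolem n\<close>. If \<open>n > 0\<close>, then its \<open>i\<close>-th column has
  support \<open>level i\<close> for every \<open>i \<le> n\<close>.

  The solutions form a closed set in Baire space, which is transferred to Cantor space by replacing
  \<open>f\<close> with the set \<open>branch f\<close> of the codes of its finite initial segments. The class consists of
  all sets \<open>X\<close> of codes of finite sequences that are closed under deleting the last entry, contain
  at most one sequence of each length, and contain only sequences without a visible violation. These
  conditions are \<open>\<Pi>\<^sup>0\<^sub>1\<close>. An infinite member is \<open>branch f\<close> for a solution \<open>f\<close>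
  (\<open>infinite_admissible\<close>), hence is \<open>branch (skolem n)\<close> for some \<open>n\<close>; this set has the degree of
  \<open>level n\<close> (\<open>branch_skolem_le\<close>, \<open>level_le_branch\<close>). The members that passing to Cantor space adds
  are finite sets, which are computable and so have the degree of \<open>level 0\<close>.
\<close>

section \<open>Computable functions on coded data\<close>

text \<open>
  Types whose elements are coded by natural numbers; \<open>enc\<close> need not be surjective (for Booleans it
  is not). Typed codings let computability proofs follow the structure of a term.
\<close>

class encodable =
  fixes enc :: "'a \<Rightarrow> nat"
  assumes enc_inject: "enc x = enc y \<Longrightarrow> x = y"

instantiation nat :: encodable
begin
definition enc_nat :: "nat \<Rightarrow> nat" where [simp]: "enc_nat n = n"
instance by standard simp
end

instantiation bool :: encodable
begin
definition enc_bool :: "bool \<Rightarrow> nat" where [simp]: "enc_bool b = of_bool b"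
instance by standard (simp add: of_bool_def split: if_splits)
end

instantiation prod :: (encodable, encodable) encodable
begin
definition enc_prod :: "'a \<times> 'b \<Rightarrow> nat" where
  [simp]: "enc_prod z = prod_encode (enc (fst z), enc (snd z))"
instance by standard (auto simp: prod_eq_iff dest: enc_inject)
end

instantiation list :: (encodable) encodable
begin
definition enc_list :: "'a list \<Rightarrow> nat" where
  [simp]: "enc_list xs = list_encode (map enc xs)"
instance
proof
  fix xs ys :: "'a list"
  assume "enc xs = enc ys"
  then have "map enc xs = map enc ys" by (simp add: list_encode_eq)
  moreover have "inj (enc :: 'a \<Rightarrow> nat)" by (auto intro: injI dest: enc_inject)
  ultimately show "xs = ys" by (simp add: inj_map_eq_map)
qed
end

text \<open>
  \<open>recursive_in X f\<close>: the total function \<open>f\<close> on coded data is computable with oracle \<open>X\<close>. Functions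
  of several arguments are functions on tuples, and predicates are functions into the Booleans, so
  that the closure rules below, which all concern terms with one free variable, suffice to establish
  computability of an explicit term by backward chaining.
\<close>

definition recursive_in :: "nat set \<Rightarrow> ('a::encodable \<Rightarrow> 'b::encodable) \<Rightarrow> bool" where
  "recursive_in X f \<longleftrightarrow> (\<exists>p. \<forall>x. run X p [enc x] = Some (enc (f x)))"

lemma turing_le_iff: "A \<le>\<^sub>T X \<longleftrightarrow> recursive_in X (\<lambda>n. n \<in> A)"
  by (simp add: turing_le_def decides_def recursive_in_def)

subsection \<open>Arithmetic programs\<close>

definition "p_add = PrimRec (Proj 0) (Comp Succ [Proj 0])"
definition "p_pred = PrimRec Zero (Proj 1)"
definition "p_sub = PrimRec (Proj 0) (Comp p_pred [Proj 0])"
definition "p_tri = PrimRec Zero (Comp p_add [Comp Succ [Proj 1], Proj 0])"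
definition "p_pair = Comp p_add [Comp p_tri [p_add], Proj 0]"
definition "p_diag = Mu (Comp p_sub [Comp p_tri [Comp Succ [Proj 0]], Comp Succ [Proj 1]])"
definition "p_fst = Comp p_sub [Comp p_tri [p_diag], Proj 0]"
definition "p_snd = Comp p_sub [p_fst, p_diag]"

lemma run_p_add: "run X p_add [m, n] = Some (m + n)"
  unfolding p_add_def by (induction m) simp_all

lemma run_p_pred: "run X p_pred [n] = Some (n - 1)"
  unfolding p_pred_def by (induction n) simp_all

lemma run_p_sub: "run X p_sub [m, n] = Some (n - m)"
  unfolding p_sub_def by (induction m) (simp_all add: run_p_pred)

lemma run_p_tri: "run X p_tri [n] = Some (triangle n)"
  unfolding p_tri_def by (induction n) (simp_all add: run_p_add)

lemma run_p_pair: "run X p_pair [m, n] = Some (prod_encode (m, n))"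
  by (simp add: p_pair_def run_p_add run_p_tri prod_encode_def)

lemma triangle_mono: "m \<le> n \<Longrightarrow> triangle m \<le> triangle n"
  by (induction n) (auto simp: le_Suc_eq)

text \<open>The diagonal on which a pair lies is found by searching for the first triangular number
  beyond its code.\<close>

lemma run_p_diag: "run X p_diag [prod_encode (m, n)] = Some (m + n)"
proof -
  let ?c = "prod_encode (m, n)"
  let ?p = "Comp p_sub [Comp p_tri [Comp Succ [Proj 0]], Comp Succ [Proj 1]]"
  have body: "run X ?p [y, ?c] = Some (Suc ?c - triangle (Suc y))" for y
    by (simp add: run_p_tri run_p_sub del: triangle_Suc)
  have hit: "Suc ?c - triangle (Suc y) = 0 \<longleftrightarrow> m + n \<le> y" for y
  proof
    assume "m + n \<le> y"
    then have "triangle (Suc (m + n)) \<le> triangle (Suc y)" by (intro triangle_mono) simp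
    then show "Suc ?c - triangle (Suc y) = 0" by (simp add: prod_encode_def)
  next
    assume *: "Suc ?c - triangle (Suc y) = 0"
    show "m + n \<le> y"
    proof (rule ccontr)
      assume "\<not> m + n \<le> y"
      then have "triangle (Suc y) \<le> triangle (m + n)" by (intro triangle_mono) simp
      with * show False by (simp add: prod_encode_def)
    qed
  qed
  have least: "(LEAST y. run X ?p [y, ?c] = Some 0) = m + n"
    unfolding body option.inject hit by (rule Least_equality) auto
  have "\<exists>y. run X ?p [y, ?c] = Some 0 \<and> (\<forall>z<y. \<exists>v. run X ?p [z, ?c] = Some (Suc v))"
    unfolding body option.inject
    by (rule exI[of _ "m + n"]) (metis hit le_refl not_le not0_implies_Suc)
  then show ?thesis
    unfolding p_diag_def run.simps(7) least by simp
qed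

lemma run_p_fst: "run X p_fst [prod_encode (m, n)] = Some m"
  by (simp add: p_fst_def run_p_diag run_p_tri run_p_sub) (simp add: prod_encode_def)

lemma run_p_snd: "run X p_snd [prod_encode (m, n)] = Some n"
  by (simp add: p_snd_def run_p_diag run_p_fst run_p_sub)

subsection \<open>Closure properties\<close>

named_theorems rec_intros

lemma rec_id [rec_intros]: "recursive_in X (\<lambda>x. x)"
  unfolding recursive_in_def by (rule exI[of _ "Proj 0"]) simp

lemma rec_const [rec_intros]: "recursive_in X (\<lambda>x. c)"
proof -
  have "\<exists>p. \<forall>x. run X p [x] = Some n" for n
  proof (induction n)
    case 0
    show ?case by (rule exI[of _ Zero]) simp
  next
    case (Suc n)
    then obtain p where "\<forall>x. run X p [x] = Some n" by blast
    then show ?case by (intro exI[of _ "Comp Succ [p]"]) simp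
  qed
  then show ?thesis unfolding recursive_in_def by blast
qed

lemma rec_comp:
  assumes "recursive_in X g" "recursive_in X f"
  shows "recursive_in X (\<lambda>x. g (f x))"
proof -
  from assms obtain p q where
    "\<And>x. run X p [enc x] = Some (enc (g x))" "\<And>x. run X q [enc x] = Some (enc (f x))"
    unfolding recursive_in_def by blast
  then have "\<And>x. run X (Comp p [q]) [enc x] = Some (enc (g (f x)))" by simp
  then show ?thesis unfolding recursive_in_def by blast
qed

text \<open>A function may be computed through any function on codes that represents it.\<close>

lemma rec_codes:
  assumes "recursive_in X (g :: nat \<Rightarrow> nat)" "\<And>x. g (enc x) = enc (f x)"
  shows "recursive_in X f"
  using assms unfolding recursive_in_def by (metis enc_nat_def)

lemma rec_Suc [rec_intros]: "recursive_in X f \<Longrightarrow> recursive_in X (\<lambda>x. Suc (f x))"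
  by (rule rec_comp[where g = Suc], unfold recursive_in_def, rule exI[of _ Succ]) simp_all

lemma rec_Pair [rec_intros]:
  assumes "recursive_in X f" "recursive_in X g"
  shows "recursive_in X (\<lambda>x. (f x, g x))"
proof -
  from assms obtain p q where
    "\<And>x. run X p [enc x] = Some (enc (f x))" "\<And>x. run X q [enc x] = Some (enc (g x))"
    unfolding recursive_in_def by blast
  then have "\<And>x. run X (Comp p_pair [p, q]) [enc x] = Some (enc (f x, g x))"
    by (simp add: run_p_pair)
  then show ?thesis unfolding recursive_in_def by blast
qed

lemma rec_fst [rec_intros]: "recursive_in X f \<Longrightarrow> recursive_in X (\<lambda>x. fst (f x))"
  by (rule rec_comp[where g = fst], unfold recursive_in_def, rule exI[of _ p_fst])
    (simp_all add: run_p_fst)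

lemma rec_snd [rec_intros]: "recursive_in X f \<Longrightarrow> recursive_in X (\<lambda>x. snd (f x))"
  by (rule rec_comp[where g = snd], unfold recursive_in_def, rule exI[of _ p_snd])
    (simp_all add: run_p_snd)

lemma rec_enc [rec_intros]: "recursive_in X f \<Longrightarrow> recursive_in X (\<lambda>x. enc (f x))"
  by (rule rec_comp[where g = enc], rule rec_codes[OF rec_id]) simp_all

lemma rec_of_bool: "recursive_in X f \<Longrightarrow> recursive_in X (\<lambda>x. of_bool (f x) :: nat)"
  by (drule rec_enc) simp

lemma rec_prod_encode [rec_intros]:
  "recursive_in X f \<Longrightarrow> recursive_in X (\<lambda>x. prod_encode (f x))"
  by (drule rec_enc) simp

lemma rec_list_encode [rec_intros]:
  "recursive_in X f \<Longrightarrow> recursive_in X (\<lambda>x. list_encode (f x))"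
  by (drule rec_enc) (simp add: map_idI)

lemma rec_prod_decode [rec_intros]:
  "recursive_in X f \<Longrightarrow> recursive_in X (\<lambda>x. prod_decode (f x))"
  by (rule rec_comp[where g = prod_decode], rule rec_codes[OF rec_id]) simp_all

lemma rec_list_decode [rec_intros]:
  "recursive_in X f \<Longrightarrow> recursive_in X (\<lambda>x. list_decode (f x))"
  by (rule rec_comp[where g = list_decode], rule rec_codes[OF rec_id]) (simp_all add: map_idI)

lemma rec_oracle: "A \<le>\<^sub>T X \<Longrightarrow> recursive_in X f \<Longrightarrow> recursive_in X (\<lambda>x. f x \<in> A)"
  by (rule rec_comp[where g = "\<lambda>n. n \<in> A"]) (simp_all add: turing_le_iff)

text \<open>
  Binding constructs extend the environment \<open>x\<close> by pairing: in the premise for \<open>g\<close>, the components of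
  \<open>z\<close> are the counter, the previous value and the old environment. The rules for bounded
  quantification and minimisation follow the same pattern.
\<close>

lemma rec_rec_nat [rec_intros]:
  assumes "recursive_in X n" "recursive_in X f"
    and "recursive_in X (\<lambda>z. g (fst z) (fst (snd z)) (snd (snd z)))"
  shows "recursive_in X (\<lambda>x. rec_nat (f x) (\<lambda>k r. g k r x) (n x))"
proof -
  from assms obtain pn pf pg where
    pn: "\<And>x. run X pn [enc x] = Some (n x)" and
    pf: "\<And>x. run X pf [enc x] = Some (enc (f x))" and
    pg: "\<And>z. run X pg [enc z] = Some (enc (g (fst z) (fst (snd z)) (snd (snd z))))"
    unfolding recursive_in_def by (metis enc_nat_def)
  have pg': "run X pg [prod_encode (k, prod_encode (enc r, enc x))] = Some (enc (g k r x))"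
    for k r x
    using pg[of "(k, r, x)"] by simp
  let ?q = "PrimRec pf (Comp pg [Comp p_pair [Proj 1, Comp p_pair [Proj 0, Proj 2]]])"
  have "run X ?q [m, enc x] = Some (enc (rec_nat (f x) (\<lambda>k r. g k r x) m))" for m x
    by (induction m) (simp_all add: pf pg' run_p_pair)
  then have "run X (Comp ?q [pn, Proj 0]) [enc x] =
      Some (enc (rec_nat (f x) (\<lambda>k r. g k r x) (n x)))" for x
    by (simp add: pn del: run.simps(6))
  then show ?thesis unfolding recursive_in_def by blast
qed

lemma rec_If [rec_intros]:
  assumes "recursive_in X c" "recursive_in X f" "recursive_in X g"
  shows "recursive_in X (\<lambda>x. if c x then f x else g x)"
proof -
  have "recursive_in X (\<lambda>x. rec_nat (g x) (\<lambda>k r. f x) (of_bool (c x)))"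
    by (intro rec_rec_nat rec_of_bool assms rec_comp[OF assms(2)] rec_intros)
  also have "(\<lambda>x. rec_nat (g x) (\<lambda>k r. f x) (of_bool (c x))) = (\<lambda>x. if c x then f x else g x)"
    by auto
  finally show ?thesis .
qed

lemma rec_not [rec_intros]:
  assumes "recursive_in X c"
  shows "recursive_in X (\<lambda>x. \<not> c x)"
  using rec_If[OF assms rec_const[of X False] rec_const[of X True]] by (simp add: if_bool_eq_conj)

lemma rec_conj [rec_intros]:
  assumes "recursive_in X c" "recursive_in X d"
  shows "recursive_in X (\<lambda>x. c x \<and> d x)"
proof -
  have "(\<lambda>x. if c x then d x else False) = (\<lambda>x. c x \<and> d x)" by auto
  with rec_If[OF assms rec_const[of X False]] show ?thesis by simp
qed

lemma rec_disj [rec_intros]: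
  assumes "recursive_in X c" "recursive_in X d"
  shows "recursive_in X (\<lambda>x. c x \<or> d x)"
  using rec_not[OF rec_conj[OF assms[THEN rec_not]]] by simp

lemma rec_imp [rec_intros]:
  assumes "recursive_in X c" "recursive_in X d"
  shows "recursive_in X (\<lambda>x. c x \<longrightarrow> d x)"
  using rec_disj[OF rec_not[OF assms(1)] assms(2)] by simp

lemma rec_minus [rec_intros]:
  fixes f g :: "'a::encodable \<Rightarrow> nat"
  assumes "recursive_in X f" "recursive_in X g"
  shows "recursive_in X (\<lambda>x. f x - g x)"
proof -
  from assms obtain p q where
    "\<And>x. run X p [enc x] = Some (f x)" "\<And>x. run X q [enc x] = Some (g x)"
    unfolding recursive_in_def by (metis enc_nat_def)
  then have "\<And>x. run X (Comp p_sub [q, p]) [enc x] = Some (enc (f x - g x))"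
    by (simp add: run_p_sub)
  then show ?thesis unfolding recursive_in_def by blast
qed

lemma rec_eq_0:
  fixes f :: "'a::encodable \<Rightarrow> nat"
  assumes "recursive_in X f"
  shows "recursive_in X (\<lambda>x. f x = 0)"
proof -
  have "recursive_in X (\<lambda>x. rec_nat True (\<lambda>_ _. False) (f x))"
    by (intro rec_intros assms)
  moreover have "rec_nat True (\<lambda>_ _. False) n \<longleftrightarrow> n = 0" for n by (cases n) simp_all
  ultimately show ?thesis by simp
qed

lemma rec_le [rec_intros]:
  fixes f g :: "'a::encodable \<Rightarrow> nat"
  assumes "recursive_in X f" "recursive_in X g"
  shows "recursive_in X (\<lambda>x. f x \<le> g x)"
  using rec_eq_0[OF rec_minus[OF assms]] by simp

lemma rec_less [rec_intros]:
  fixes f g :: "'a::encodable \<Rightarrow> nat"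
  assumes "recursive_in X f" "recursive_in X g"
  shows "recursive_in X (\<lambda>x. f x < g x)"
  using rec_not[OF rec_le[OF assms(2,1)]] by (simp add: not_le)

lemma rec_eq [rec_intros]:
  assumes "recursive_in X f" "recursive_in X g"
  shows "recursive_in X (\<lambda>x. f x = g x)"
proof -
  have "recursive_in X (\<lambda>x. enc (f x) \<le> enc (g x) \<and> enc (g x) \<le> enc (f x))"
    by (intro rec_intros assms)
  moreover have "enc (f x) \<le> enc (g x) \<and> enc (g x) \<le> enc (f x) \<longleftrightarrow> f x = g x" for x
    by (auto dest: enc_inject)
  ultimately show ?thesis by simp
qed

lemma rec_all_less [rec_intros]:
  fixes P :: "nat \<Rightarrow> 'a::encodable \<Rightarrow> bool"
  assumes "recursive_in X n" "recursive_in X (\<lambda>z. P (fst z) (snd z))"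
  shows "recursive_in X (\<lambda>x. \<forall>k<n x. P k x)"
proof -
  have "recursive_in X (\<lambda>x. rec_nat True (\<lambda>k r. r \<and> P k x) (n x))"
    using rec_comp[OF assms(2), where f = "\<lambda>z. (fst z, snd (snd z))"]
    by (intro rec_intros assms) (simp_all add: rec_intros)
  moreover have "rec_nat True (\<lambda>k r. r \<and> P k x) m \<longleftrightarrow> (\<forall>k<m. P k x)" for m x
    by (induction m) (auto simp: less_Suc_eq)
  ultimately show ?thesis by simp
qed

lemma rec_ex_less [rec_intros]:
  fixes P :: "nat \<Rightarrow> 'a::encodable \<Rightarrow> bool"
  assumes "recursive_in X n" "recursive_in X (\<lambda>z. P (fst z) (snd z))"
  shows "recursive_in X (\<lambda>x. \<exists>k<n x. P k x)"
  using rec_not[OF rec_all_less[OF assms(1) rec_not[OF assms(2)]]] by simp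

lemma rec_Least:
  fixes P :: "nat \<Rightarrow> 'a::encodable \<Rightarrow> bool"
  assumes "recursive_in X (\<lambda>z. P (fst z) (snd z))" "\<And>x. \<exists>y. P y x"
  shows "recursive_in X (\<lambda>x. LEAST y. P y x)"
proof -
  from rec_not[OF assms(1)] obtain p where
    p: "\<And>z. run X p [enc z] = Some (of_bool (\<not> P (fst z) (snd z)))"
    unfolding recursive_in_def by (metis enc_bool_def)
  let ?p = "Comp p [p_pair]"
  have body: "run X ?p [y, enc x] = Some (of_bool (\<not> P y x))" for y x
    using p[of "(y, x)"] by (simp add: run_p_pair)
  have least: "\<exists>y. P y x \<and> (\<forall>z<y. \<not> P z x)" for x
    using assms(2)[of x] by (subst (asm) exists_least_iff)
  have "\<exists>y. run X ?p [y, enc x] = Some 0 \<and> (\<forall>z<y. \<exists>v. run X ?p [z, enc x] = Some (Suc v))"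
    for x :: 'a
    unfolding body using least[of x] by simp blast
  moreover have "(LEAST y. run X ?p [y, enc x] = Some 0) = (LEAST y. P y x)" for x
    unfolding body by simp
  ultimately have "run X (Mu ?p) [enc x] = Some (LEAST y. P y x)" for x
    by (simp del: run.simps(5))
  then show ?thesis unfolding recursive_in_def by (metis enc_nat_def)
qed

subsection \<open>Lists\<close>

lemma rec_Cons [rec_intros]:
  assumes "recursive_in X f" "recursive_in X g"
  shows "recursive_in X (\<lambda>x. f x # g x)"
proof -
  have "recursive_in X (\<lambda>z. fst z # snd z)"
    by (rule rec_codes[where g = Suc]) (auto intro: rec_intros)
  from rec_comp[OF this rec_Pair[OF assms]] show ?thesis by simp
qed

lemma rec_tl [rec_intros]:
  assumes "recursive_in X f"
  shows "recursive_in X (\<lambda>x. tl (f x))"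
proof (rule rec_comp[where g = tl, OF _ assms],
    rule rec_codes[where g = "\<lambda>c. snd (prod_decode (c - 1))"])
  show "recursive_in X (\<lambda>c. snd (prod_decode (c - 1)))" by (intro rec_intros)
  have "prod_decode 0 = (0, 0)" using prod_encode_inverse[of "(0, 0)"] by (simp add: prod_encode_def)
  then show "snd (prod_decode (enc xs - 1)) = enc (tl xs)" for xs :: "'b list"
    by (cases xs) simp_all
qed

lemma rec_hd [rec_intros]:
  assumes "recursive_in X f"
  shows "recursive_in X (\<lambda>x. hd (f x))"
proof (rule rec_comp[where g = hd, OF _ assms], rule rec_codes)
  let ?g = "\<lambda>c. if c = 0 then enc (hd [] :: 'b) else fst (prod_decode (c - 1))"
  show "recursive_in X ?g" by (intro rec_intros)
  show "?g (enc xs) = enc (hd xs)" for xs :: "'b list"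
    by (cases xs) simp_all
qed

text \<open>
  The \<open>i\<close>-th entry of \<open>l\<close> is written \<open>hd (drop i l)\<close> rather than \<open>l ! i\<close>, because the former is
  constant beyond the end of \<open>l\<close> and therefore computable as it stands.
\<close>

lemma rec_drop [rec_intros]:
  assumes "recursive_in X n" "recursive_in X f"
  shows "recursive_in X (\<lambda>x. drop (n x) (f x))"
proof -
  have "recursive_in X (\<lambda>x. rec_nat (f x) (\<lambda>_ r. tl r) (n x))"
    by (intro rec_intros assms)
  moreover have "rec_nat xs (\<lambda>_ r. tl r) m = drop m xs" for m and xs :: "'b list"
    by (induction m) (simp_all add: drop_Suc tl_drop)
  ultimately show ?thesis by simp
qed

lemma rec_length [rec_intros]:
  assumes "recursive_in X f"
  shows "recursive_in X (\<lambda>x. length (f x))"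
proof -
  have "recursive_in X (\<lambda>xs :: 'b list. LEAST n. drop n xs = [])"
    by (rule rec_Least, intro rec_intros) auto
  moreover have "(LEAST n. drop n xs = []) = length xs" for xs :: "'b list"
    by (rule Least_equality) auto
  ultimately show ?thesis using rec_comp[OF _ assms, where g = length] by simp
qed

lemma rec_bex_set [rec_intros]:
  assumes "recursive_in X l" "recursive_in X (\<lambda>z. P (fst z) (snd z))"
  shows "recursive_in X (\<lambda>x. \<exists>y\<in>set (l x). P y x)"
proof -
  have "recursive_in X (\<lambda>x. \<exists>i<length (l x). P (hd (drop i (l x))) x)"
    using rec_comp[OF assms(2), where f = "\<lambda>z. (hd (drop (fst z) (l (snd z))), snd z)"]
    by (intro rec_intros assms) (simp add: rec_intros rec_comp[OF assms(1)])
  moreover have "(\<exists>i<length ys. P (hd (drop i ys)) x) \<longleftrightarrow> (\<exists>y\<in>set ys. P y x)" for x ys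
    by (metis hd_drop_conv_nth in_set_conv_nth)
  ultimately show ?thesis by simp
qed

lemma rec_ball_set [rec_intros]:
  assumes "recursive_in X l" "recursive_in X (\<lambda>z. P (fst z) (snd z))"
  shows "recursive_in X (\<lambda>x. \<forall>y\<in>set (l x). P y x)"
  using rec_not[OF rec_bex_set[OF assms(1) rec_not[OF assms(2)]]] by simp

lemma rec_in_set [rec_intros]:
  assumes "recursive_in X f" "recursive_in X l"
  shows "recursive_in X (\<lambda>x. f x \<in> set (l x))"
proof -
  have "recursive_in X (\<lambda>x. \<exists>y\<in>set (l x). y = f x)"
    by (intro rec_intros assms rec_comp[OF assms(1)])
  then show ?thesis by (simp cong: bex_cong)
qed

section \<open>Finite derivations and the jump\<close>

text \<open>
  The first entry of the list coded by a program is a tag for the outermost constructor; the further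
  entries are the arguments of the constructor.
\<close>

fun prog_code :: "prog \<Rightarrow> nat" where
  "prog_code Zero = list_encode [0]"
| "prog_code Succ = list_encode [1]"
| "prog_code (Proj i) = list_encode [2, i]"
| "prog_code Query = list_encode [3]"
| "prog_code (Comp p qs) = list_encode (4 # prog_code p # map prog_code qs)"
| "prog_code (PrimRec p q) = list_encode [5, prog_code p, prog_code q]"
| "prog_code (Mu p) = list_encode [6, prog_code p]"

text \<open>
  The triple \<open>(c, xs, y)\<close> stands for the claim that the program with code \<open>c\<close>, applied to \<open>xs\<close>,
  yields \<open>y\<close>.
\<close>

type_synonym claim = "nat \<times> nat list \<times> nat"

abbreviation "code_of j \<equiv> fst (j :: claim)"
abbreviation "args_of j \<equiv> fst (snd (j :: claim))"
abbreviation "value_of j \<equiv> snd (snd (j :: claim))"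

abbreviation at :: "'a list \<Rightarrow> nat \<Rightarrow> 'a" where
  "at l i \<equiv> hd (drop i l)"

text \<open>
  A claim \<open>j\<close> is justified by the claims in \<open>D\<close> if it follows from them by the defining equation of
  \<^const>\<open>run\<close> for its outermost constructor. The oracle enters through \<open>b\<close> only, the answer to the
  query about the first argument; thus the relation itself is decidable without an oracle. Every
  existential witness is taken from a member of \<open>D\<close>, which keeps all quantifiers bounded.
\<close>

definition justified :: "bool \<Rightarrow> claim list \<Rightarrow> claim \<Rightarrow> bool" where
  "justified b D j \<longleftrightarrow>
     (at (list_decode (code_of j)) 0 = 0 \<and> value_of j = 0) \<or>
     (at (list_decode (code_of j)) 0 = 1 \<and> length (args_of j) = 1 \<and> value_of j = Suc (hd (args_of j))) \<or>
     (at (list_decode (code_of j)) 0 = 2 \<and> at (list_decode (code_of j)) 1 < length (args_of j) \<and>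
        value_of j = at (args_of j) (at (list_decode (code_of j)) 1)) \<or>
     (at (list_decode (code_of j)) 0 = 3 \<and> length (args_of j) = 1 \<and> value_of j = (if b then 1 else 0)) \<or>
     (at (list_decode (code_of j)) 0 = 4 \<and>
        (\<exists>i\<in>set D. code_of i = at (list_decode (code_of j)) 1 \<and> value_of i = value_of j \<and>
           length (args_of i) = length (drop 2 (list_decode (code_of j))) \<and>
           (\<forall>k<length (args_of i).
              (at (drop 2 (list_decode (code_of j))) k, args_of j, at (args_of i) k) \<in> set D))) \<or>
     (at (list_decode (code_of j)) 0 = 5 \<and> args_of j \<noteq> [] \<and>
        (if hd (args_of j) = 0 then (at (list_decode (code_of j)) 1, tl (args_of j), value_of j) \<in> set D
         else \<exists>i\<in>set D. code_of i = code_of j \<and> args_of i = (hd (args_of j) - 1) # tl (args_of j) \<and>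
                (at (list_decode (code_of j)) 2, value_of i # args_of i, value_of j) \<in> set D)) \<or>
     (at (list_decode (code_of j)) 0 = 6 \<and>
        (at (list_decode (code_of j)) 1, value_of j # args_of j, 0) \<in> set D \<and>
        (\<forall>z<value_of j. \<exists>i\<in>set D. code_of i = at (list_decode (code_of j)) 1 \<and>
           args_of i = z # args_of j \<and> 0 < value_of i))"

lemma rec_justified:
  "recursive_in X (\<lambda>z. justified (fst z) (fst (snd z)) (snd (snd z)))"
  unfolding justified_def by (intro rec_intros)

lemma justified_mono: "justified b D j \<Longrightarrow> set D \<subseteq> set D' \<Longrightarrow> justified b D' j"
  unfolding justified_def by (elim disj_forward conj_forward asm_rl) (auto split: if_splits, (blast+)?)

text \<open>
  A finite set of claims all of which are justified by the set itself. No order among the claims is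
  required: a claim about the code of a program is justified by claims about subprograms or, for
  primitive recursion, about a smaller recursion argument, so that it cannot depend on itself.
\<close>

definition derivation :: "nat set \<Rightarrow> claim list \<Rightarrow> bool" where
  "derivation A D \<longleftrightarrow> (\<forall>j\<in>set D. justified (args_of j \<noteq> [] \<and> hd (args_of j) \<in> A) D j)"

lemma derivation_append: "derivation A D \<Longrightarrow> derivation A E \<Longrightarrow> derivation A (D @ E)"
  using justified_mono[of _ D _ "D @ E"] justified_mono[of _ E _ "D @ E"]
  by (simp add: derivation_def ball_Un)

lemma derivation_Cons:
  "derivation A D \<Longrightarrow> justified (args_of j \<noteq> [] \<and> hd (args_of j) \<in> A) D j \<Longrightarrow> derivation A (j # D)"
  using justified_mono[of _ D _ "j # D"]
  by (simp add: derivation_def subset_insertI)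

lemma those_eq_Some_iff: "those xs = Some ys \<longleftrightarrow> xs = map Some ys"
proof (induction xs arbitrary: ys)
  case Nil
  then show ?case by auto
next
  case (Cons x xs)
  then show ?case by (cases x; cases ys) auto
qed

lemma derivationD:
  "derivation A D \<Longrightarrow> (c, xs, y) \<in> set D \<Longrightarrow> justified (xs \<noteq> [] \<and> hd xs \<in> A) D (c, xs, y)"
  unfolding derivation_def by fastforce

lemma derivation_sound:
  assumes "derivation A D"
  shows "(prog_code p, xs, y) \<in> set D \<Longrightarrow> run A p xs = Some y"
proof (induction p arbitrary: xs y)
  case Zero
  from derivationD[OF assms this] show ?case by (simp add: justified_def)
next
  case Succ
  from derivationD[OF assms this] show ?case by (auto simp: justified_def length_Suc_conv)
next
  case (Proj i)
  from derivationD[OF assms this] show ?case by (simp add: justified_def hd_drop_conv_nth)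
next
  case Query
  from derivationD[OF assms this] show ?case by (auto simp: justified_def length_Suc_conv)
next
  case (Comp p qs)
  from derivationD[OF assms Comp.prems] obtain zs where
    zs: "(prog_code p, zs, y) \<in> set D" "length zs = length qs"
      "\<And>k. k < length zs \<Longrightarrow> (at (map prog_code qs) k, xs, at zs k) \<in> set D"
    by (auto simp: justified_def)
  have "run A (qs ! k) xs = Some (zs ! k)" if "k < length qs" for k
    using Comp.IH(2)[of "qs ! k" xs "zs ! k"] zs(2) zs(3)[of k] that
    by (simp add: hd_drop_conv_nth)
  then have "map (\<lambda>q. run A q xs) qs = map Some zs"
    using zs(2) by (simp add: list_eq_iff_nth_eq)
  then have "those (map (\<lambda>q. run A q xs) qs) = Some zs" by (simp add: those_eq_Some_iff)
  with Comp.IH(1)[OF zs(1)] show ?case by simp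
next
  case (PrimRec p q)
  have "run A (PrimRec p q) (n # zs) = Some y"
    if "(prog_code (PrimRec p q), n # zs, y) \<in> set D" for n zs y
    using that
  proof (induction n arbitrary: y)
    case 0
    from derivationD[OF assms this] have "(prog_code p, zs, y) \<in> set D"
      by (simp add: justified_def)
    with PrimRec.IH(1) show ?case by simp
  next
    case (Suc n)
    from derivationD[OF assms Suc.prems]
    obtain r where "(prog_code (PrimRec p q), n # zs, r) \<in> set D"
      and "(prog_code q, r # n # zs, y) \<in> set D"
      by (auto simp: justified_def)
    with Suc.IH PrimRec.IH(2) show ?case by simp
  qed
  moreover from derivationD[OF assms PrimRec.prems] have "xs \<noteq> []" by (simp add: justified_def)
  ultimately show ?case using PrimRec.prems by (cases xs) blast+
next
  case (Mu p)
  from derivationD[OF assms Mu.prems] have "(prog_code p, y # xs, 0) \<in> set D"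
    and *: "\<forall>z<y. \<exists>v. (prog_code p, z # xs, v) \<in> set D \<and> 0 < v"
    by (auto simp: justified_def) (metis prod.collapse)
  then have y: "run A p (y # xs) = Some 0" using Mu.IH by blast
  have below: "\<exists>v. run A p (z # xs) = Some (Suc v)" if "z < y" for z
    using * Mu.IH that by (metis gr0_conv_Suc)
  have "(LEAST y. run A p (y # xs) = Some 0) = y"
  proof (rule Least_equality)
    show "y \<le> z" if "run A p (z # xs) = Some 0" for z
      using below[of z] that by (cases "z < y") auto
  qed (rule y)
  moreover have "\<exists>y. run A p (y # xs) = Some 0 \<and> (\<forall>z<y. \<exists>v. run A p (z # xs) = Some (Suc v))"
    using y below by blast
  ultimately show ?case by simp
qed

lemma derivation_union:
  assumes "finite J" "\<And>j. j \<in> J \<Longrightarrow> \<exists>D. derivation A D \<and> j \<in> set D"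
  shows "\<exists>D. derivation A D \<and> J \<subseteq> set D"
  using assms
proof (induction J)
  case empty
  have "derivation A []" by (simp add: derivation_def)
  then show ?case by blast
next
  case (insert j J)
  then obtain D E where "derivation A D" "j \<in> set D" "derivation A E" "J \<subseteq> set E" by blast
  then have "derivation A (D @ E)" "insert j J \<subseteq> set (D @ E)" by (auto intro: derivation_append)
  then show ?case by blast
qed

text \<open>
  The inductive step for completeness: a claim that is justified by finitely many derivable claims
  is derivable.
\<close>

lemma derivable:
  assumes "finite J" "\<And>j. j \<in> J \<Longrightarrow> \<exists>D. derivation A D \<and> j \<in> set D"
    and "\<And>D. J \<subseteq> set D \<Longrightarrow> justified (xs \<noteq> [] \<and> hd xs \<in> A) D (p, xs, y)"
  shows "\<exists>D. derivation A D \<and> (p, xs, y) \<in> set D"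
proof -
  obtain D where "derivation A D" "J \<subseteq> set D" using derivation_union[OF assms(1,2)] by blast
  then have "derivation A ((p, xs, y) # D)" by (intro derivation_Cons) (simp_all add: assms(3))
  then show ?thesis by (metis list.set_intros(1))
qed

lemma derivation_complete:
  "run A p xs = Some y \<Longrightarrow> \<exists>D. derivation A D \<and> (prog_code p, xs, y) \<in> set D"
proof (induction p arbitrary: xs y)
  case Zero
  then show ?case by (intro derivable[of "{}"]) (auto simp: justified_def)
next
  case Succ
  then show ?case by (intro derivable[of "{}"]) (auto simp: justified_def split: list.splits)
next
  case (Proj i)
  then show ?case
    by (intro derivable[of "{}"]) (auto simp: justified_def hd_drop_conv_nth split: if_splits)
next
  case Query
  then show ?case by (intro derivable[of "{}"]) (auto simp: justified_def split: list.splits)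
next
  case (Comp p qs)
  then obtain zs where zs: "those (map (\<lambda>q. run A q xs) qs) = Some zs" "run A p zs = Some y"
    by (auto split: option.splits)
  then have eq: "map (\<lambda>q. run A q xs) qs = map Some zs" by (simp add: those_eq_Some_iff)
  then have len: "length zs = length qs" by (metis length_map)
  have run: "run A (qs ! k) xs = Some (zs ! k)" if "k < length qs" for k
    using that arg_cong[OF eq, of "\<lambda>l. l ! k"] len by simp
  let ?J = "insert (prog_code p, zs, y) ((\<lambda>k. (prog_code (qs ! k), xs, zs ! k)) ` {..<length qs})"
  show ?case
  proof (rule derivable[of ?J])
    show "\<exists>D. derivation A D \<and> j \<in> set D" if "j \<in> ?J" for j
      using that Comp.IH(1)[OF zs(2)] Comp.IH(2)[OF _ run] by auto
    show "justified (xs \<noteq> [] \<and> hd xs \<in> A) D (prog_code (Comp p qs), xs, y)"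
      if "?J \<subseteq> set D" for D
      using that len unfolding justified_def
      by (auto simp: hd_drop_conv_nth image_subset_iff intro!: bexI[of _ "(prog_code p, zs, y)"])
  qed simp
next
  case (PrimRec p q)
  have "\<exists>D. derivation A D \<and> (prog_code (PrimRec p q), n # zs, y) \<in> set D"
    if "run A (PrimRec p q) (n # zs) = Some y" for n zs y
    using that
  proof (induction n arbitrary: y)
    case 0
    then show ?case using PrimRec.IH(1)[of zs y]
      by (intro derivable[of "{(prog_code p, zs, y)}"]) (auto simp: justified_def)
  next
    case (Suc n)
    then obtain r where r: "run A (PrimRec p q) (n # zs) = Some r" "run A q (r # n # zs) = Some y"
      by (auto split: option.splits)
    let ?J = "{(prog_code (PrimRec p q), n # zs, r), (prog_code q, r # n # zs, y)}"
    show ?case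
    proof (rule derivable[of ?J])
      show "\<exists>D. derivation A D \<and> j \<in> set D" if "j \<in> ?J" for j
        using that Suc.IH[OF r(1)] PrimRec.IH(2)[OF r(2)] by blast
      show "justified (Suc n # zs \<noteq> [] \<and> hd (Suc n # zs) \<in> A) D
          (prog_code (PrimRec p q), Suc n # zs, y)" if "?J \<subseteq> set D" for D
        using that unfolding justified_def
        by (auto intro!: bexI[of _ "(prog_code (PrimRec p q), n # zs, r)"])
    qed simp
  qed
  moreover have "xs \<noteq> []" using PrimRec.prems by auto
  ultimately show ?case using PrimRec.prems by (cases xs) blast+
next
  case (Mu p)
  then have ex: "\<exists>y. run A p (y # xs) = Some 0 \<and> (\<forall>z<y. \<exists>v. run A p (z # xs) = Some (Suc v))"
    by (simp split: if_splits) blast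
  have y: "y = (LEAST y. run A p (y # xs) = Some 0)"
    using Mu.prems by (simp split: if_splits)
  from ex obtain y' where y': "run A p (y' # xs) = Some 0"
    "\<And>z. z < y' \<Longrightarrow> \<exists>v. run A p (z # xs) = Some (Suc v)" by blast
  have "y = y'"
    unfolding y
  proof (rule Least_equality)
    show "y' \<le> z" if "run A p (z # xs) = Some 0" for z
      using y'(2)[of z] that by (cases "z < y'") auto
  qed (rule y'(1))
  with y' obtain v where v: "run A p (y # xs) = Some 0"
    "\<And>z. z < y \<Longrightarrow> run A p (z # xs) = Some (Suc (v z))" by metis
  let ?J = "insert (prog_code p, y # xs, 0) ((\<lambda>z. (prog_code p, z # xs, Suc (v z))) ` {..<y})"
  show ?case
  proof (rule derivable[of ?J])
    show "\<exists>D. derivation A D \<and> j \<in> set D" if "j \<in> ?J" for j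
      using that Mu.IH[OF v(1)] Mu.IH[OF v(2)] by auto
    show "justified (xs \<noteq> [] \<and> hd xs \<in> A) D (prog_code (Mu p), xs, y)" if "?J \<subseteq> set D" for D
    proof -
      have J: "(prog_code p, y # xs, 0) \<in> set D"
        "\<And>z. z < y \<Longrightarrow> (prog_code p, z # xs, Suc (v z)) \<in> set D"
        using that by auto
      show ?thesis
        by (auto simp: justified_def J(1) intro!: bexI[OF _ J(2)])
    qed
  qed simp
qed

text \<open>
  The inverse of \<open>enc\<close> on lists of claims, which is a bijection onto the natural numbers.
\<close>

definition decode_derivation :: "nat \<Rightarrow> claim list" where
  "decode_derivation t =
     map (\<lambda>c. (fst (prod_decode c), list_decode (fst (prod_decode (snd (prod_decode c)))),
               snd (prod_decode (snd (prod_decode c))))) (list_decode t)"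

lemma enc_decode_derivation [simp]: "enc (decode_derivation t) = t"
  by (simp add: decode_derivation_def o_def map_idI)

lemma decode_derivation_enc [simp]: "decode_derivation (enc D) = D"
  by (rule enc_inject) (rule enc_decode_derivation)

lemma rec_decode_derivation [rec_intros]:
  "recursive_in X f \<Longrightarrow> recursive_in X (\<lambda>x. decode_derivation (f x))"
  by (rule rec_comp[where g = decode_derivation], rule rec_codes[OF rec_id])
    (simp_all del: enc_list_def)

lemma less_list_encode: "x \<in> set xs \<Longrightarrow> x < list_encode xs"
proof (induction xs)
  case (Cons y xs)
  have "list_encode (y # xs) = Suc (prod_encode (y, list_encode xs))" by simp
  then show ?case
    using Cons le_prod_encode_1[of y "list_encode xs"] le_prod_encode_2[of "list_encode xs" y] by auto
qed simp

text \<open>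
  \<open>halting_witness A e t\<close>: \<open>t\<close> codes a derivation relative to \<open>A\<close> of some value for the computation
  \<open>e = \<langle>c, n\<rangle>\<close>, that is, for the program with code \<open>c\<close> on input \<open>n\<close>.
\<close>

definition halting_witness :: "nat set \<Rightarrow> nat \<Rightarrow> nat \<Rightarrow> bool" where
  "halting_witness A e t \<longleftrightarrow> derivation A (decode_derivation t) \<and>
     (\<exists>j\<in>set (decode_derivation t).
        code_of j = fst (prod_decode e) \<and> args_of j = [snd (prod_decode e)])"

text \<open>
  Here the oracle \<open>A x\<close> of the derivation may vary with the input \<open>x\<close>, as long as membership in it is
  decidable uniformly in \<open>x\<close>. This allows finite approximations read off from the input.
\<close>

lemma rec_halting_witness:
  fixes A :: "'a::encodable \<Rightarrow> nat set"
  assumes "recursive_in X (\<lambda>z. fst z \<in> A (snd z))" "recursive_in X e" "recursive_in X t"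
  shows "recursive_in X (\<lambda>x. halting_witness (A x) (e x) (t x))"
proof -
  have *: "recursive_in X (\<lambda>z. justified (b z) (D z) (j z))"
    if "recursive_in X b" "recursive_in X D" "recursive_in X j"
    for b D and j :: "'b::encodable \<Rightarrow> claim"
    using rec_comp[OF rec_justified[of X] rec_Pair[OF that(1) rec_Pair[OF that(2,3)]]] by simp
  have "recursive_in X (\<lambda>z :: claim \<times> 'a. hd (args_of (fst z)) \<in> A (snd z))"
    using rec_comp[OF assms(1), where f = "\<lambda>z :: claim \<times> 'a. (hd (args_of (fst z)), snd z)"]
    by (simp add: rec_intros)
  then show ?thesis
    unfolding halting_witness_def derivation_def
    by (intro * rec_intros assms rec_comp[OF assms(2)] rec_comp[OF assms(3)])
qed

text \<open>
  The use principle: a derivation mentions only numbers smaller than its own code.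
\<close>

lemma halting_witness_use:
  assumes "\<And>y. y < t \<Longrightarrow> y \<in> A \<longleftrightarrow> y \<in> B"
  shows "halting_witness A e t \<longleftrightarrow> halting_witness B e t"
proof -
  have *: "hd (args_of j) \<in> A \<longleftrightarrow> hd (args_of j) \<in> B"
    if "j \<in> set (decode_derivation t)" "args_of j \<noteq> []" for j
  proof (rule assms)
    have "enc j \<in> set (map enc (decode_derivation t))" using that(1) by simp
    then have "enc j < enc (decode_derivation t)" unfolding enc_list_def by (rule less_list_encode)
    then have "enc j < t" unfolding enc_decode_derivation .
    moreover have "hd (args_of j) < list_encode (args_of j)"
      using that(2) by (simp add: less_list_encode)
    moreover have "list_encode (args_of j) \<le> enc (snd j)"
      by (simp add: le_prod_encode_1 map_idI)
    moreover have "enc (snd j) \<le> enc j" by (simp add: le_prod_encode_2)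
    ultimately show "hd (args_of j) < t" by linarith
  qed
  have "(args_of j \<noteq> [] \<and> hd (args_of j) \<in> A) = (args_of j \<noteq> [] \<and> hd (args_of j) \<in> B)"
    if "j \<in> set (decode_derivation t)" for j
    using *[OF that] by (rule conj_cong[OF refl])
  then show ?thesis
    unfolding halting_witness_def derivation_def
    by (intro conj_cong ball_cong refl) (simp only:)
qed

text \<open>
  The halting problem relative to \<open>A\<close>, as a set of pairs of a program code and an input.
\<close>

definition jump :: "nat set \<Rightarrow> nat set" where
  "jump A = {e. \<exists>t. halting_witness A e t}"

lemma jump_iff: "prod_encode (prog_code p, n) \<in> jump A \<longleftrightarrow> run A p [n] \<noteq> None"
proof
  assume "prod_encode (prog_code p, n) \<in> jump A"
  then obtain t y where "derivation A (decode_derivation t)"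
    "(prog_code p, [n], y) \<in> set (decode_derivation t)"
    by (auto simp: jump_def halting_witness_def)
  then show "run A p [n] \<noteq> None" using derivation_sound by blast
next
  assume "run A p [n] \<noteq> None"
  then obtain D y where "derivation A D" "(prog_code p, [n], y) \<in> set D"
    using derivation_complete by blast
  then have "halting_witness A (prod_encode (prog_code p, n)) (enc D)"
    unfolding halting_witness_def decode_derivation_enc by force
  then show "prod_encode (prog_code p, n) \<in> jump A" unfolding jump_def by blast
qed

lemma le_jump: "A \<le>\<^sub>T jump A"
proof -
  obtain p where p: "\<And>n. run A p [n] = Some (of_bool (n \<notin> A))"
    using rec_not[OF rec_oracle[OF turing_le_refl rec_id]] unfolding recursive_in_def
    by (metis enc_bool_def enc_nat_def)
  (* ?q searches for a zero of a function that is constant in the search variable *)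
  let ?q = "Mu (Comp p [Proj 1])"
  have "n \<in> A \<longleftrightarrow> prod_encode (prog_code ?q, n) \<in> jump A" for n
    unfolding jump_iff by (auto simp: p)
  then show ?thesis
    unfolding turing_le_iff by (simp only:) (intro rec_oracle[OF turing_le_refl] rec_intros)
qed

lemma not_jump_le: "\<not> jump A \<le>\<^sub>T A"
proof
  assume "jump A \<le>\<^sub>T A"
  then have "recursive_in A (\<lambda>n. prod_encode (n, n) \<in> jump A)"
    by (intro rec_oracle rec_intros)
  then obtain p where p: "\<And>n. run A p [n] = Some (of_bool (prod_encode (n, n) \<in> jump A))"
    unfolding recursive_in_def by (metis enc_bool_def enc_nat_def)
  (* ?q halts on n exactly if the program with code n does not halt on n *)
  let ?q = "Mu (Comp p [Proj 1])"
  let ?d = "prod_encode (prog_code ?q, prog_code ?q)"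
  have "run A ?q [n] \<noteq> None \<longleftrightarrow> prod_encode (n, n) \<notin> jump A" for n
    by (cases "prod_encode (n, n) \<in> jump A") (auto simp: p intro!: exI[of _ "0::nat"])
  then have "?d \<in> jump A \<longleftrightarrow> ?d \<notin> jump A"
    using jump_iff[of ?q "prog_code ?q" A] by blast
  then show False by blast
qed

section \<open>Iterated jumps and their witness functions\<close>

text \<open>
  The iterated jumps. Starting from \<open>UNIV\<close> rather than the empty set makes \<open>level 0\<close> the support of
  the nonzero constant column \<open>0\<close> of \<open>skolem n\<close>, for \<open>n > 0\<close>.
\<close>

primrec level :: "nat \<Rightarrow> nat set" where
  "level 0 = UNIV"
| "level (Suc n) = jump (level n)"

lemma level_mono: "m \<le> n \<Longrightarrow> level m \<le>\<^sub>T level n"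
proof (induction n rule: dec_induct)
  case base
  show ?case by (rule turing_le_refl)
next
  case (step n)
  from turing_le_trans[OF this(3) le_jump] show ?case by simp
qed

definition least_witness :: "nat set \<Rightarrow> nat \<Rightarrow> nat \<Rightarrow> bool" where
  "least_witness A e t \<longleftrightarrow> halting_witness A e t \<and> (\<forall>u<t. \<not> halting_witness A e u)"

lemma least_witness_use:
  "(\<And>y. y < t \<Longrightarrow> y \<in> A \<longleftrightarrow> y \<in> B) \<Longrightarrow> least_witness A e t \<longleftrightarrow> least_witness B e t"
  unfolding least_witness_def
  using halting_witness_use[of t A B e] halting_witness_use[of _ A B e]
  by (metis order.strict_trans)

lemma rec_least_witness:
  fixes A :: "'a::encodable \<Rightarrow> nat set"
  assumes "recursive_in X (\<lambda>z. fst z \<in> A (snd z))" "recursive_in X e" "recursive_in X t"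
  shows "recursive_in X (\<lambda>x. least_witness (A x) (e x) (t x))"
proof -
  have "recursive_in X (\<lambda>z :: nat \<times> nat \<times> 'a. fst z \<in> A (snd (snd z)))"
    using rec_comp[OF assms(1), where f = "\<lambda>z :: nat \<times> nat \<times> 'a. (fst z, snd (snd z))"]
    by (simp add: rec_intros)
  then show ?thesis
    unfolding least_witness_def
    by (intro rec_halting_witness rec_intros assms rec_comp[OF assms(2)])
qed

text \<open>
  The function with parameter \<open>n\<close> whose columns \<open>1, \<dots>, n\<close> record the least halting witnesses,
  shifted by one, for the first \<open>n\<close> jumps.
\<close>

definition skolem :: "nat \<Rightarrow> nat \<Rightarrow> nat" where
  "skolem n j = (case prod_decode j of (i, e) \<Rightarrow>
     if i = 0 then n
     else if n < i \<or> e \<notin> level i then 0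
     else Suc (LEAST t. halting_witness (level (i - 1)) e t))"

text \<open>
  The condition characterising the functions \<open>skolem n\<close>. The oracle for column \<open>i\<close> is the support
  of column \<open>i - 1\<close> of \<open>f\<close> itself. Each instance of the condition, given by \<open>i\<close>, \<open>e\<close> and \<open>t\<close>,
  depends on finitely many values of \<open>f\<close>.
\<close>

definition coherent :: "(nat \<Rightarrow> nat) \<Rightarrow> bool" where
  "coherent f \<longleftrightarrow> (\<forall>i e.
     (i = 0 \<longrightarrow> f (prod_encode (i, e)) = f 0) \<and>
     (f 0 < i \<longrightarrow> f (prod_encode (i, e)) = 0) \<and>
     (0 < i \<and> i \<le> f 0 \<longrightarrow> (\<forall>t. f (prod_encode (i, e)) = Suc t \<longleftrightarrow>
        least_witness {y. 0 < f (prod_encode (i - 1, y))} e t)))"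

lemma prod_decode_0: "prod_decode 0 = (0, 0)"
  using prod_encode_inverse[of "(0, 0)"] by (simp add: prod_encode_def)

lemma skolem_0: "skolem n 0 = n"
  by (simp add: skolem_def prod_decode_0)

lemma skolem_pos_iff:
  assumes "0 < n" "i \<le> n"
  shows "0 < skolem n (prod_encode (i, y)) \<longleftrightarrow> y \<in> level i"
  using assms by (auto simp: skolem_def)

lemma skolem_eq_Suc_iff:
  assumes "0 < i" "i \<le> n"
  shows "skolem n (prod_encode (i, e)) = Suc t \<longleftrightarrow> least_witness (level (i - 1)) e t"
proof (cases "e \<in> level i")
  case True
  have level: "level i = jump (level (i - 1))" using assms(1) by (cases i) simp_all
  let ?P = "halting_witness (level (i - 1)) e"
  have ex: "\<exists>t. ?P t" using True unfolding level jump_def by simp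
  have "Least ?P = t \<longleftrightarrow> least_witness (level (i - 1)) e t"
  proof
    assume "Least ?P = t"
    then show "least_witness (level (i - 1)) e t"
      unfolding least_witness_def using LeastI_ex[OF ex] not_less_Least[of _ ?P] by blast
  next
    assume "least_witness (level (i - 1)) e t"
    then show "Least ?P = t"
      unfolding least_witness_def by (intro Least_equality) (auto simp: not_less[symmetric])
  qed
  then show ?thesis using assms True by (simp add: skolem_def)
next
  case False
  have "level i = jump (level (i - 1))" using assms(1) by (cases i) simp_all
  with False have "\<not> halting_witness (level (i - 1)) e t" by (auto simp: jump_def)
  then show ?thesis using assms False by (simp add: skolem_def least_witness_def)
qed

lemma coherent_skolem: "coherent (skolem n)"
  unfolding coherent_def
proof (intro allI conjI impI, unfold skolem_0)
  fix i e t
  show "skolem n (prod_encode (i, e)) = n" if "i = 0"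
    using that by (simp add: skolem_def)
  show "skolem n (prod_encode (i, e)) = 0" if "n < i"
    using that by (simp add: skolem_def)
  assume i: "0 < i \<and> i \<le> n"
  then have "{y. 0 < skolem n (prod_encode (i - 1, y))} = level (i - 1)"
    by (subst skolem_pos_iff) auto
  with i show "skolem n (prod_encode (i, e)) = Suc t \<longleftrightarrow>
      least_witness {y. 0 < skolem n (prod_encode (i - 1, y))} e t"
    by (simp add: skolem_eq_Suc_iff)
qed

lemma coherent_unique:
  assumes "coherent f" "coherent g" "f 0 = g 0"
  shows "f = g"
proof -
  have "\<forall>e. f (prod_encode (i, e)) = g (prod_encode (i, e))" for i
  proof (induction i)
    case 0
    then show ?case using assms unfolding coherent_def by metis
  next
    case (Suc i)
    show ?case
    proof (cases "f 0 < Suc i")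
      case True
      then show ?thesis using assms unfolding coherent_def by metis
    next
      case False
      have *: "h (prod_encode (Suc i, e)) = Suc t \<longleftrightarrow>
          least_witness {y. 0 < h (prod_encode (i, y))} e t"
        if "coherent h" "h 0 = f 0" for h e t
        using that(1)[unfolded coherent_def, rule_format, of "Suc i" e] that(2) False by simp
      have "f (prod_encode (Suc i, e)) = Suc t \<longleftrightarrow> g (prod_encode (Suc i, e)) = Suc t" for e t
        using *[of f e t] *[of g e t] Suc.IH assms by simp
      then show ?thesis by (metis not0_implies_Suc)
    qed
  qed
  then show "f = g" by (metis ext prod_decode_inverse surj_pair)
qed

section \<open>The effectively closed class\<close>

text \<open>
  Initial segments of a function are stored with the last entry first, so that deleting the last
  entry is \<^const>\<open>tl\<close>; \<open>val l j\<close> is the value at \<open>j\<close> of the finite function stored in \<open>l\<close>.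
\<close>

abbreviation val :: "nat list \<Rightarrow> nat \<Rightarrow> nat" where
  "val l j \<equiv> at l (length l - Suc j)"

text \<open>
  The part of the support of column \<open>i\<close> that is visible in \<open>l\<close>.
\<close>

definition column :: "nat list \<Rightarrow> nat \<Rightarrow> nat set" where
  "column l i = {y. prod_encode (i, y) < length l \<and> 0 < val l (prod_encode (i, y))}"

text \<open>
  The finite sequence \<open>l\<close> shows no violation of coherence. The condition at \<open>t\<close> is imposed only if
  \<open>l\<close> reaches the entry \<open>t\<close> of column \<open>i - 1\<close>; then it determines the oracle below \<open>t\<close>, which is all
  that a witness \<open>t\<close> can use.
\<close>

definition good :: "nat list \<Rightarrow> bool" where
  "good l \<longleftrightarrow> (\<forall>j<length l.
     (fst (prod_decode j) = 0 \<longrightarrow> val l j = val l 0) \<and>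
     (val l 0 < fst (prod_decode j) \<longrightarrow> val l j = 0) \<and>
     (0 < fst (prod_decode j) \<and> fst (prod_decode j) \<le> val l 0 \<longrightarrow>
        (\<forall>t<length l. prod_encode (fst (prod_decode j) - 1, t) < length l \<longrightarrow>
          (val l j = Suc t) =
            least_witness (column l (fst (prod_decode j) - 1)) (snd (prod_decode j)) t)))"

lemma rec_column [rec_intros]:
  assumes "recursive_in X y" "recursive_in X l" "recursive_in X i"
  shows "recursive_in X (\<lambda>x. y x \<in> column (l x) (i x))"
  unfolding column_def mem_Collect_eq by (intro rec_intros assms)

lemma rec_good: "recursive_in X f \<Longrightarrow> recursive_in X (\<lambda>x. good (f x))"
  by (rule rec_comp[where g = good], unfold good_def) (intro rec_intros rec_least_witness)

definition segment :: "(nat \<Rightarrow> nat) \<Rightarrow> nat \<Rightarrow> nat list" where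
  "segment f k = rev (map f [0..<k])"

lemma length_segment [simp]: "length (segment f k) = k"
  by (simp add: segment_def)

lemma segment_Suc: "segment f (Suc k) = f k # segment f k"
  by (simp add: segment_def)

lemma val_segment: "j < k \<Longrightarrow> at (segment f k) (k - Suc j) = f j"
  by (simp add: hd_drop_conv_nth segment_def rev_nth)

lemma prod_encode_mono: "s \<le> t \<Longrightarrow> prod_encode (i, s) \<le> prod_encode (i, t)"
  by (simp add: prod_encode_def triangle_mono)

lemma column_segment_use:
  assumes "prod_encode (i, t) < k"
  shows "least_witness (column (segment f k) i) e t \<longleftrightarrow>
    least_witness {y. 0 < f (prod_encode (i, y))} e t"
proof (rule least_witness_use)
  fix y assume "y < t"
  then have "prod_encode (i, y) < k" using assms prod_encode_mono[of y t i] by simp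
  then show "y \<in> column (segment f k) i \<longleftrightarrow> y \<in> {y. 0 < f (prod_encode (i, y))}"
    by (simp add: column_def val_segment)
qed

text \<open>
  Every single condition of coherence is tested by all sufficiently long initial segments.
\<close>

lemma good_segments_iff: "(\<forall>k. good (segment f k)) \<longleftrightarrow> coherent f"
proof
  assume f: "coherent f"
  show "\<forall>k. good (segment f k)"
    unfolding good_def length_segment
  proof (intro allI impI)
    fix k j :: nat assume j: "j < k"
    obtain i e where ie: "j = prod_encode (i, e)" by (metis prod_decode_inverse surj_pair)
    then have decode: "prod_decode j = (i, e)" by simp
    have "(i = 0 \<longrightarrow> f j = f 0) \<and> (f 0 < i \<longrightarrow> f j = 0) \<and> (0 < i \<and> i \<le> f 0 \<longrightarrow>
        (\<forall>t<k. prod_encode (i - 1, t) < k \<longrightarrow>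
          (f j = Suc t) = least_witness (column (segment f k) (i - 1)) e t))"
      using f[unfolded coherent_def, rule_format, of i e] column_segment_use[of "i - 1" _ k f e]
      by (simp add: ie)
    then show "(fst (prod_decode j) = 0 \<longrightarrow>
          at (segment f k) (k - Suc j) = at (segment f k) (k - Suc 0)) \<and>
       (at (segment f k) (k - Suc 0) < fst (prod_decode j) \<longrightarrow>
          at (segment f k) (k - Suc j) = 0) \<and>
       (0 < fst (prod_decode j) \<and> fst (prod_decode j) \<le> at (segment f k) (k - Suc 0) \<longrightarrow>
        (\<forall>t<k. prod_encode (fst (prod_decode j) - 1, t) < k \<longrightarrow>
          (at (segment f k) (k - Suc j) = Suc t) =
            least_witness (column (segment f k) (fst (prod_decode j) - 1))
              (snd (prod_decode j)) t))"
      using val_segment[OF j, of f] val_segment[of 0 k f] j by (simp add: decode)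
  qed
next
  assume good: "\<forall>k. good (segment f k)"
  show "coherent f"
    unfolding coherent_def
  proof (intro allI)
    fix i e
    define j where "j = prod_encode (i, e)"
    then have decode: "prod_decode j = (i, e)" by simp
    have *: "(i = 0 \<longrightarrow> f j = f 0) \<and> (f 0 < i \<longrightarrow> f j = 0) \<and> (0 < i \<and> i \<le> f 0 \<longrightarrow>
        (\<forall>t<k. prod_encode (i - 1, t) < k \<longrightarrow>
          (f j = Suc t) = least_witness {y. 0 < f (prod_encode (i - 1, y))} e t))"
      if "j < k" for k
    proof -
      have "0 < k" using that by simp
      from good[rule_format, of k, unfolded good_def length_segment, rule_format, OF that]
      show ?thesis
        using val_segment[OF that, of f] val_segment[OF \<open>0 < k\<close>, of f]
          column_segment_use[of "i - 1" _ k f e] by (simp add: decode)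
    qed
    have "(f j = Suc t) = least_witness {y. 0 < f (prod_encode (i - 1, y))} e t"
      if "0 < i \<and> i \<le> f 0" for t
    proof -
      (* the bound is past all positions that the condition mentions *)
      have "t < Suc (j + prod_encode (i - 1, t))" using le_prod_encode_2[of t "i - 1"] by simp
      with *[of "Suc (j + prod_encode (i - 1, t))"] that show ?thesis by simp
    qed
    with *[of "Suc j"] have "(i = 0 \<longrightarrow> f j = f 0) \<and> (f 0 < i \<longrightarrow> f j = 0) \<and>
        (0 < i \<and> i \<le> f 0 \<longrightarrow> (\<forall>t. (f j = Suc t) =
          least_witness {y. 0 < f (prod_encode (i - 1, y))} e t))"
      by blast
    then show "(i = 0 \<longrightarrow> f (prod_encode (i, e)) = f 0) \<and>
        (f 0 < i \<longrightarrow> f (prod_encode (i, e)) = 0) \<and>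
        (0 < i \<and> i \<le> f 0 \<longrightarrow> (\<forall>t. (f (prod_encode (i, e)) = Suc t) =
          least_witness {y. 0 < f (prod_encode (i - 1, y))} e t))"
      unfolding j_def .
  qed
qed

text \<open>
  The conditions defining the class, restricted to the elements of \<open>X\<close> below \<open>n\<close>: closure under
  deleting the last entry, at most one sequence of each length, and no violation of coherence.
  Deleting an entry decreases the code, so that only \<open>X \<inter> {..<n}\<close> matters.
\<close>

definition admissible :: "nat set \<Rightarrow> nat \<Rightarrow> bool" where
  "admissible X n \<longleftrightarrow> (\<forall>c<n. c \<in> X \<longrightarrow>
     (list_decode c \<noteq> [] \<longrightarrow> list_encode (tl (list_decode c)) \<in> X) \<and>
     (\<forall>d<n. d \<in> X \<and> length (list_decode d) = length (list_decode c) \<longrightarrow> d = c) \<and>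
     good (list_decode c))"

text \<open>
  The tree of the class: a string belongs to it if the positions of its ones satisfy the conditions.
\<close>

definition chain_tree :: "bool list set" where
  "chain_tree = {s. admissible {c. c < length s \<and> s ! c} (length s)}"

lemma list_encode_tl_le: "list_encode (tl l) \<le> list_encode l"
  by (cases l) (auto intro: le_SucI le_prod_encode_2)

lemma admissible_antimono:
  assumes "admissible X n" "m \<le> n" "\<And>c. c < m \<Longrightarrow> c \<in> Y \<longleftrightarrow> c \<in> X"
  shows "admissible Y m"
  unfolding admissible_def
proof (intro allI impI)
  fix c assume c: "c < m" "c \<in> Y"
  have "list_encode (tl (list_decode c)) < m"
    using list_encode_tl_le[of "list_decode c"] c(1) by simp
  with c assms show "(list_decode c \<noteq> [] \<longrightarrow> list_encode (tl (list_decode c)) \<in> Y) \<and>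
     (\<forall>d<m. d \<in> Y \<and> length (list_decode d) = length (list_decode c) \<longrightarrow> d = c) \<and>
     good (list_decode c)"
    unfolding admissible_def by (metis order.strict_trans2)
qed

lemma downward_closed_chain_tree: "downward_closed chain_tree"
  unfolding downward_closed_def chain_tree_def
  by (auto elim!: admissible_antimono simp: prefix_def nth_append)

lemma computable_chain_tree: "computable_strings chain_tree"
proof -
  have "n \<in> string_code ` chain_tree \<longleftrightarrow>
      (\<forall>x\<in>set (list_decode n). x \<le> 1) \<and>
      admissible {c. c < length (list_decode n) \<and> at (list_decode n) c = 1} (length (list_decode n))"
    (is "_ \<longleftrightarrow> ?R n") for n
  proof
    assume "n \<in> string_code ` chain_tree"
    then obtain s where s: "s \<in> chain_tree" "list_decode n = map of_bool s"
      by (auto simp: string_code_def)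
    have "{c. c < length (list_decode n) \<and> at (list_decode n) c = 1} = {c. c < length s \<and> s ! c}"
      unfolding s(2) by (auto simp: hd_drop_conv_nth of_bool_def split: if_splits)
    with s show "?R n" by (auto simp: chain_tree_def)
  next
    assume R: "?R n"
    let ?s = "map (\<lambda>x. x = 1) (list_decode n)"
    have "{c. c < length (list_decode n) \<and> at (list_decode n) c = 1} = {c. c < length ?s \<and> ?s ! c}"
      by (auto simp: hd_drop_conv_nth)
    with R have "?s \<in> chain_tree" by (simp add: chain_tree_def)
    moreover have "map of_bool ?s = list_decode n"
      using R by (auto intro!: map_idI simp: o_def le_Suc_eq)
    then have "string_code ?s = n" by (simp only: string_code_def list_decode_inverse)
    ultimately show "n \<in> string_code ` chain_tree" by (metis imageI)
  qed
  moreover have "recursive_in {} ?R"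
    unfolding admissible_def mem_Collect_eq by (intro rec_good rec_intros)
  ultimately show ?thesis
    unfolding computable_strings_def computable_iff_turing_le_empty turing_le_iff by simp
qed

lemma paths_chain_tree: "paths chain_tree = {X. \<forall>n. admissible X n}"
proof -
  have "initial_segment X n \<in> chain_tree \<longleftrightarrow> admissible X n" for X n
    unfolding chain_tree_def mem_Collect_eq
    by (auto simp: initial_segment_def elim!: admissible_antimono)
  then show ?thesis by (simp add: paths_def)
qed

text \<open>
  The member of Cantor space representing \<open>f\<close>: all codes of its initial segments.
\<close>

definition branch :: "(nat \<Rightarrow> nat) \<Rightarrow> nat set" where
  "branch f = range (\<lambda>k. list_encode (segment f k))"

lemma branch_admissible:
  assumes "coherent f"
  shows "admissible (branch f) n"
proof -
  have "tl (segment f k) = segment f (k - 1)" for k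
    by (cases k) (simp_all add: segment_Suc segment_def)
  moreover have "good (segment f k)" for k using assms good_segments_iff by blast
  ultimately show ?thesis unfolding admissible_def branch_def by auto
qed

text \<open>
  Since the length is injective on \<open>X\<close>, an infinite \<open>X\<close> contains arbitrarily long sequences, and by
  closure under deletion one of every length. They extend each other and define \<open>f\<close>.
\<close>

lemma infinite_admissible:
  assumes adm: "\<And>n. admissible X n" and "infinite X"
  obtains f where "coherent f" "X = branch f"
proof -
  have tl: "list_encode (tl l) \<in> X" if "list_encode l \<in> X" for l
    using adm[of "Suc (list_encode l)"] that unfolding admissible_def by (cases l) auto
  have good: "good l" if "list_encode l \<in> X" for l
    using adm[of "Suc (list_encode l)"] that unfolding admissible_def by auto
  have uniq: "l = m" if "list_encode l \<in> X" "list_encode m \<in> X" "length l = length m" for l m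
  proof -
    have "list_encode m = list_encode l"
      using adm[of "Suc (list_encode l + list_encode m)", unfolded admissible_def, rule_format,
          of "list_encode l"] that by simp
    then show ?thesis by (simp add: list_encode_eq)
  qed
  have drop: "list_encode (drop i l) \<in> X" if "list_encode l \<in> X" for i l
  proof (induction i)
    case (Suc i)
    from tl[OF this] show ?case by (simp add: drop_Suc tl_drop)
  qed (simp add: that)
  have "\<exists>l. list_encode l \<in> X \<and> length l = k" for k
  proof (rule ccontr)
    assume none: "\<nexists>l. list_encode l \<in> X \<and> length l = k"
    have "length (list_decode c) < k" if "c \<in> X" for c
    proof (rule ccontr)
      assume "\<not> length (list_decode c) < k"
      then have "length (drop (length (list_decode c) - k) (list_decode c)) = k" by simp
      with drop[of "list_decode c" "length (list_decode c) - k"] none that show False by auto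
    qed
    then have "(\<lambda>c. length (list_decode c)) ` X \<subseteq> {..<k}" by auto
    then have "finite ((\<lambda>c. length (list_decode c)) ` X)" by (rule finite_subset) simp
    moreover have "inj_on (\<lambda>c. length (list_decode c)) X"
    proof (rule inj_onI)
      fix c d assume "c \<in> X" "d \<in> X" "length (list_decode c) = length (list_decode d)"
      then have "list_decode c = list_decode d" by (intro uniq) simp_all
      then show "c = d" by (metis list_decode_inverse)
    qed
    ultimately show False using \<open>infinite X\<close> finite_imageD by blast
  qed
  then obtain s where s: "\<And>k. list_encode (s k) \<in> X" "\<And>k. length (s k) = k" by metis
  define f where "f k = hd (s (Suc k))" for k
  have seg: "segment f k = s k" for k
  proof (induction k)
    case 0
    show ?case using s(2)[of 0] by (simp add: segment_def)
  next
    case (Suc k)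
    have "tl (s (Suc k)) = s k" using s tl by (intro uniq) simp_all
    moreover have "s (Suc k) \<noteq> []" using s(2)[of "Suc k"] by auto
    ultimately show ?case using Suc by (simp add: segment_Suc f_def) (metis list.collapse)
  qed
  have "X = branch f"
  proof (intro equalityI subsetI)
    fix c assume "c \<in> X"
    then have "list_decode c = s (length (list_decode c))" by (intro uniq) (simp_all add: s)
    then have "c = list_encode (segment f (length (list_decode c)))"
      unfolding seg by (metis list_decode_inverse)
    then show "c \<in> branch f" unfolding branch_def by blast
  next
    fix c assume "c \<in> branch f"
    then show "c \<in> X" by (auto simp: branch_def seg s)
  qed
  moreover have "coherent f"
    unfolding good_segments_iff[symmetric] seg using s(1) good by blast
  ultimately show ?thesis using that by blast
qed

section \<open>Degrees of the members\<close>

lemma finite_turing_le: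
  assumes "finite A"
  shows "A \<le>\<^sub>T X"
  using assms unfolding turing_le_iff
  by (induction A) (simp_all, (intro rec_intros)+)

lemma UNIV_turing_le: "UNIV \<le>\<^sub>T X"
  unfolding turing_le_iff by (simp add: rec_const)

text \<open>
  Up to \<open>n\<close>, the iterated jumps are computable uniformly in their index from the \<open>n\<close>-th one.
\<close>

lemma rec_levels:
  "m \<le> n \<Longrightarrow> recursive_in (level n) (\<lambda>z. fst z \<le> m \<and> snd z \<in> level (fst z))"
proof (induction m)
  case 0
  have "recursive_in (level n) (\<lambda>z :: nat \<times> nat. fst z = 0)" by (intro rec_intros)
  moreover have "(\<lambda>z. fst z \<le> 0 \<and> snd z \<in> level (fst z)) = (\<lambda>z. fst z = 0)" by auto
  ultimately show ?case by (simp only:)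
next
  case (Suc m)
  have "recursive_in (level n) (\<lambda>z. (fst z \<le> m \<and> snd z \<in> level (fst z)) \<or>
      (fst z = Suc m \<and> snd z \<in> level (Suc m)))"
    using Suc.prems by (intro rec_disj Suc.IH rec_intros rec_oracle[OF level_mono]) simp_all
  moreover have "(\<lambda>z. (fst z \<le> m \<and> snd z \<in> level (fst z)) \<or> (fst z = Suc m \<and> snd z \<in> level (Suc m))) =
      (\<lambda>z. fst z \<le> Suc m \<and> snd z \<in> level (fst z))"
    by (auto simp: le_Suc_eq simp del: level.simps)
  ultimately show ?case by (simp only:)
qed

lemma rec_skolem_graph: "recursive_in (level n) (\<lambda>z. skolem n (fst z) = snd z)"
proof -
  let ?i = "\<lambda>z :: nat \<times> nat. fst (prod_decode (fst z))"
  let ?e = "\<lambda>z :: nat \<times> nat. snd (prod_decode (fst z))"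
  let ?R = "\<lambda>z. if ?i z = 0 then snd z = n
    else if n < ?i z then snd z = 0
    else if snd z = 0 then \<not> (?i z \<le> n \<and> ?e z \<in> level (?i z))
    else least_witness {y. ?i z - 1 \<le> n \<and> y \<in> level (?i z - 1)} (?e z) (snd z - 1)"
  have *: "recursive_in (level n) (\<lambda>x. i x \<le> n \<and> e x \<in> level (i x))"
    if "recursive_in (level n) i" "recursive_in (level n) e" for i e :: "'a::encodable \<Rightarrow> nat"
    using rec_comp[OF rec_levels[OF order_refl] rec_Pair[OF that]] by simp
  (* the guard i - 1 <= n makes the oracle decidable for arbitrary z *)
  have "recursive_in (level n) ?R"
    by (intro rec_If rec_not rec_least_witness, unfold mem_Collect_eq) (intro * rec_intros)+
  moreover have "skolem n (fst z) = snd z \<longleftrightarrow> ?R z" for z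
  proof (cases "0 < ?i z \<and> ?i z \<le> n")
    case True
    then have "{y. ?i z - 1 \<le> n \<and> y \<in> level (?i z - 1)} = level (?i z - 1)" by auto
    moreover have "skolem n (fst z) = Suc t \<longleftrightarrow> least_witness (level (?i z - 1)) (?e z) t" for t
      using skolem_eq_Suc_iff[of "?i z" n "?e z" t] True by simp
    moreover have "0 < skolem n (fst z) \<longleftrightarrow> ?e z \<in> level (?i z)"
      using skolem_pos_iff[of n "?i z" "?e z"] True by simp
    ultimately show ?thesis using True by (cases "snd z") auto
  next
    case False
    then show ?thesis by (auto simp: skolem_def split: prod.splits)
  qed
  ultimately show ?thesis by (simp only:)
qed

text \<open>
  Membership in \<open>branch f\<close> needs only the graph of \<open>f\<close>, without a search for the values of \<open>f\<close>.
\<close>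

lemma branch_iff: "c \<in> branch f \<longleftrightarrow> (\<forall>j<length (list_decode c). f j = val (list_decode c) j)"
proof
  assume "c \<in> branch f"
  then show "\<forall>j<length (list_decode c). f j = val (list_decode c) j"
    by (auto simp: branch_def val_segment)
next
  let ?l = "list_decode c"
  assume *: "\<forall>j<length ?l. f j = val ?l j"
  have "?l = segment f (length ?l)"
  proof (rule nth_equalityI)
    fix k assume k: "k < length ?l"
    with * have "f (length ?l - Suc k) = ?l ! k" by (simp add: hd_drop_conv_nth Suc_diff_Suc)
    with k show "?l ! k = segment f (length ?l) ! k" by (simp add: segment_def rev_nth)
  qed simp
  then have "c = list_encode (segment f (length ?l))" by (metis list_decode_inverse)
  then show "c \<in> branch f" unfolding branch_def by blast
qed

lemma branch_skolem_le: "branch (skolem n) \<le>\<^sub>T level n"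
proof -
  have *: "recursive_in (level n) (\<lambda>x. skolem n (j x) = v x)"
    if "recursive_in (level n) j" "recursive_in (level n) v" for j v :: "'a::encodable \<Rightarrow> nat"
    using rec_comp[OF rec_skolem_graph rec_Pair[OF that]] by simp
  then show ?thesis
    unfolding turing_le_iff branch_iff by (intro rec_all_less) (intro * rec_intros)+
qed

lemma level_le_branch: "level n \<le>\<^sub>T branch (skolem n)"
proof (cases "n = 0")
  case True
  then show ?thesis by (simp add: UNIV_turing_le)
next
  case False
  let ?B = "branch (skolem n)"
  let ?P = "\<lambda>c e. c \<in> ?B \<and> prod_encode (n, e) < length (list_decode c)"
  have ex: "\<exists>c. ?P c e" for e
    by (rule exI[of _ "list_encode (segment (skolem n) (Suc (prod_encode (n, e))))"])
      (simp add: branch_def)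
  have "recursive_in ?B (\<lambda>e. LEAST c. ?P c e)"
    by (rule rec_Least[OF _ ex]) (intro rec_intros rec_oracle turing_le_refl)
  then have "recursive_in ?B (\<lambda>e. 0 < val (list_decode (LEAST c. ?P c e)) (prod_encode (n, e)))"
    by (intro rec_intros)
  moreover have "0 < val (list_decode (LEAST c. ?P c e)) (prod_encode (n, e)) \<longleftrightarrow> e \<in> level n" for e
  proof -
    have "0 < val (list_decode c) (prod_encode (n, e)) \<longleftrightarrow> e \<in> level n" if "?P c e" for c
      using that skolem_pos_iff[of n n e] False by (simp add: branch_iff)
    from this[OF LeastI_ex[of "\<lambda>c. ?P c e", OF ex]] show ?thesis .
  qed
  ultimately show ?thesis unfolding turing_le_iff by (simp only:)
qed

lemma degree_of_eq_iff: "degree_of A = degree_of B \<longleftrightarrow> A \<equiv>\<^sub>T B"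
  by transfer rule

lemma degree_of_le_iff: "degree_of A \<le> degree_of B \<longleftrightarrow> A \<le>\<^sub>T B"
  by transfer rule

lemma strict_chain_levels: "strict_chain (\<lambda>n. degree_of (level n))"
  unfolding strict_chain_def
proof (intro allI impI)
  fix n m :: nat
  assume "n < m"
  have "degree_of (level n) < degree_of (level (Suc n))" for n
    by (simp add: less_turing_degree_def degree_of_le_iff le_jump not_jump_le)
  then show "degree_of (level n) < degree_of (level m)"
    using \<open>n < m\<close> by (rule lift_Suc_mono_less)
qed

theorem theorem4:
  "\<exists>P :: nat set set. pi01_class P \<and>
     (\<exists>a :: nat \<Rightarrow> turing_degree. strict_chain a \<and> degree_spectrum P = range a)"
proof (intro exI conjI)
  show "pi01_class (paths chain_tree)"
    unfolding pi01_class_def using computable_chain_tree downward_closed_chain_tree by blast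
  show "strict_chain (\<lambda>n. degree_of (level n))" by (rule strict_chain_levels)
  have branch: "degree_of (branch (skolem n)) = degree_of (level n)" for n
    by (simp add: degree_of_eq_iff turing_equiv_def branch_skolem_le level_le_branch)
  show "degree_spectrum (paths chain_tree) = range (\<lambda>n. degree_of (level n))"
  proof (intro equalityI subsetI)
    fix a assume "a \<in> degree_spectrum (paths chain_tree)"
    then obtain X where adm: "\<And>n. admissible X n" and a: "a = degree_of X"
      by (auto simp: degree_spectrum_def paths_chain_tree)
    show "a \<in> range (\<lambda>n. degree_of (level n))"
    proof (cases "finite X")
      case True
      then have "degree_of X = degree_of (level 0)"
        by (simp add: degree_of_eq_iff turing_equiv_def finite_turing_le UNIV_turing_le)
      then show ?thesis using a by blast
    next
      case False
      with adm obtain f where f: "coherent f" "X = branch f" by (rule infinite_admissible)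
      have "f = skolem (f 0)"
        using f(1) coherent_skolem by (rule coherent_unique) (simp add: skolem_0)
      then have "degree_of X = degree_of (level (f 0))" using branch f(2) by metis
      then show ?thesis using a by blast
    qed
  next
    fix a assume "a \<in> range (\<lambda>n. degree_of (level n))"
    then obtain n where "a = degree_of (branch (skolem n))" by (auto simp: branch)
    moreover have "branch (skolem n) \<in> paths chain_tree"
      unfolding paths_chain_tree using branch_admissible[OF coherent_skolem] by blast
    ultimately show "a \<in> degree_spectrum (paths chain_tree)"
      unfolding degree_spectrum_def by blast
  qed
qed

end
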